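(* There is an absolute constant $c>0$ such that the following holds. Let $R$ be an $n\times n$ irreducible, $\frac12$-lazy nonnegative matrix with PF eigenvalue $1$ and positive left and right eigenvectors $u,v$ normalized so that $\langle u,v\rangle=1$, and let $\kappa(R)=\min_i u_iv_i$. Then for every $0<\epsilon<1$, \[ \tau_\epsilon(R)\le c\cdot\frac{n+\ln\!\left(\frac{1}{\epsilon\cdot\kappa(R)}\right)}{\Delta(R)}. \]
   Context: $R$ is $\frac12$-lazy if $R_{i,i}\ge\frac12$ for all $i$. Irreducible: for all $s,t$ there is $k>0$ with $(R^k)_{s,t}>0$; then the PF eigenvalue is simple with positive eigenvectors. $D_u$ is the diagonal matrix with $u$ on the diagonal. The mixing time $\tau_\epsilon(R)$ is the smallest nonnegative integer $\tau$ such that $\|D_u(R^\tau-v u^T)x\|_1\le\epsilon$ for every real vector $x$ with $\|D_ux\|_1=1$. The spectral gap is $\Delta(R)=1-\operatorname{Re}\lambda_2(R)$, where the eigenvalues are ordered $1=\lambda_1>\operatorname{Re}\lambda_2\ge\cdots\ge\operatorname{Re}\lambda_n$. *)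

theory Defs
  imports "Jordan_Normal_Form.Spectral_Radius"
    "HOL-Computational_Algebra.Fundamental_Theorem_Algebra"
begin

definition nonneg_mat :: "real mat \<Rightarrow> bool" where
  "nonneg_mat R \<longleftrightarrow> (\<forall>i < dim_row R. \<forall>j < dim_col R. R $$ (i,j) \<ge> 0)"

definition half_lazy :: "real mat \<Rightarrow> bool" where
  "half_lazy R \<longleftrightarrow> (\<forall>i < dim_row R. R $$ (i,i) \<ge> 1/2)"

definition irreducible_mat :: "real mat \<Rightarrow> bool" where
  "irreducible_mat R \<longleftrightarrow>
     (\<forall>s < dim_row R. \<forall>t < dim_row R. \<exists>k > 0. (R ^\<^sub>m k) $$ (s,t) > 0)"

definition PF_eigenvalue :: "real mat \<Rightarrow> real" where
  "PF_eigenvalue R = spectral_radius (map_mat complex_of_real R)"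

definition diag_of_vec :: "real vec \<Rightarrow> real mat" where
  "diag_of_vec u = mat (dim_vec u) (dim_vec u) (\<lambda>(i,j). if i = j then u $ i else 0)"

definition norm1_vec :: "real vec \<Rightarrow> real" where
  "norm1_vec x = (\<Sum>i < dim_vec x. \<bar>x $ i\<bar>)"

definition kappa :: "real vec \<Rightarrow> real vec \<Rightarrow> real" where
  "kappa u v = Min ((\<lambda>i. u $ i * v $ i) ` {..< dim_vec u})"

definition mixing_time :: "real mat \<Rightarrow> real vec \<Rightarrow> real vec \<Rightarrow> real \<Rightarrow> nat" where
  "mixing_time R u v \<epsilon> = (LEAST \<tau>. \<forall>x \<in> carrier_vec (dim_row R).
       norm1_vec (diag_of_vec u *\<^sub>v x) = 1 \<longrightarrow>
       norm1_vec (diag_of_vec u *\<^sub>v ((R ^\<^sub>m \<tau> - mat (dim_row R) (dim_row R) (\<lambda>(i,j). v $ i * u $ j)) *\<^sub>v x)) \<le> \<epsilon>)"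

definition eigenvalues_mset :: "real mat \<Rightarrow> complex multiset" where
  "eigenvalues_mset R = proots (char_poly (map_mat complex_of_real R))"

definition spectral_gap :: "real mat \<Rightarrow> real" where
  "spectral_gap R = 1 - rev (sorted_list_of_multiset (image_mset Re (eigenvalues_mset R))) ! 1"

end

theory Submission
  imports Defs "HOL-Analysis.Convex"
begin

text \<open>In the inner product with weights \<open>u i / v i\<close> both \<open>R\<close> and \<open>2R - I\<close> are contractions.
  Hence every eigenvalue satisfies \<open>\<bar>\<lambda>\<bar>\<^sup>2 \<le> Re \<lambda>\<close>, and those other than \<open>1\<close> satisfy
  \<open>\<bar>\<lambda>\<bar>\<^sup>2 \<le> 1 - \<Delta>\<close>. Triangularize \<open>R\<close> with eigenvalue \<open>1\<close> first and divide by its eigenvector \<open>v\<close>.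
  For a contraction in triangular form, row \<open>i\<close> with diagonal entry \<open>\<lambda>\<close> can move at most
  \<open>(1 - \<bar>\<lambda>\<bar>\<^sup>2)\<close> times the energy lost by the later coordinates into coordinate \<open>i\<close>.
  Therefore a diagonal Lyapunov function, with weights growing by a factor \<open>3\<close> per coordinate, decays by
  \<open>1 - \<Delta>/4\<close> per step, and \<open>\<parallel>R\<^sup>N z\<parallel>\<^sup>2 \<le> 3\<^sup>n (1 - \<Delta>/4)\<^sup>N \<parallel>z\<parallel>\<^sup>2\<close> for \<open>z\<close> orthogonal to \<open>v\<close>.
  Comparing with the weighted \<open>1\<close>-norm costs only a factor \<open>1 / \<kappa>\<close>.\<close>

section \<open>Triangular contractions of a semi-inner product\<close>

text \<open>Only semidefinite, because every quotient taken below has a kernel. Tolerating null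
  vectors keeps all quotients on the same function space.\<close>

locale psd_form =
  fixes h :: "('k \<Rightarrow> complex) \<Rightarrow> ('k \<Rightarrow> complex) \<Rightarrow> complex"
  assumes linear_left: "h (\<lambda>k. x k + t * y k) z = h x z + t * h y z"
    and hermitian: "cnj (h x y) = h y x"
    and nonneg: "0 \<le> Re (h x x)"
begin

lemma linear_right: "h z (\<lambda>k. x k + t * y k) = h z x + cnj t * h z y"
  by (metis (mono_tags, lifting) complex_cnj_add complex_cnj_mult hermitian linear_left)

lemma self_real: "h x x = of_real (Re (h x x))"
  using hermitian[of x x] by (metis Reals_cnj_iff of_real_Re)

text \<open>If \<open>h x z\<close> were nonzero, moving \<open>z\<close> along the null vector
  \<open>x\<close> would change the form linearly and eventually make it negative.\<close>

lemma null_left: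
  assumes "h x x = 0" shows "h x z = 0"
proof (rule ccontr)
  assume nz: "h x z \<noteq> 0"
  define m where "m = (cmod (h x z))\<^sup>2"
  have m: "m > 0" using nz by (simp add: m_def)
  \<comment> \<open>This size makes the form at \<open>z + t * x\<close> equal to -1.\<close>
  define s where "s = (Re (h z z) + 1) / (2 * m)"
  define t where "t = - of_real s * cnj (h x z)"
  have "h (\<lambda>k. z k + t * x k) (\<lambda>k. z k + t * x k)
      = h z z + cnj t * h z x + t * h x z + t * cnj t * h x x"
    by (simp add: linear_left linear_right algebra_simps)
  also have "\<dots> = h z z - of_real (2 * s) * (h x z * h z x)"
    using assms by (simp add: t_def hermitian)
  also have "h x z * h z x = of_real m"
    by (simp add: m_def complex_norm_square hermitian del: of_real_power)
  finally have "0 \<le> Re (h z z) - 2 * s * m"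
    using nonneg[of "\<lambda>k. z k + t * x k"] by simp
  then show False using m by (simp add: s_def)
qed

lemma null_right: "h x x = 0 \<Longrightarrow> h z x = 0"
  using null_left[of x z] hermitian[of x z] by simp

lemma null_shift:
  assumes "h y y = 0"
  shows "h (\<lambda>k. x k + t * y k) (\<lambda>k. x k + t * y k) = h x x"
  by (simp add: linear_left linear_right null_left[OF assms] null_right[OF assms])

end

text \<open>The quotient of a form by \<open>w\<close>. If \<open>h w w = 0\<close>, division by zero gives
  \<open>quot_form h w = h\<close>, which is again the right form, so no case distinction is needed below.\<close>

definition quot_form :: "('a \<Rightarrow> 'a \<Rightarrow> complex) \<Rightarrow> 'a \<Rightarrow> 'a \<Rightarrow> 'a \<Rightarrow> complex" where
  "quot_form h w x y = h x y - h x w * h w y / h w w"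

context psd_form
begin

text \<open>Pythagoras: the subtracted term is the energy of the component of \<open>x\<close> along
  \<open>w\<close>.\<close>

lemma quot_form_self: "Re (quot_form h w x x) = Re (h x x) - (cmod (h x w))\<^sup>2 / Re (h w w)"
proof -
  have "h x w * h w x / h w w = of_real ((cmod (h x w))\<^sup>2 / Re (h w w))"
    by (subst self_real[of w])
      (simp add: hermitian[of x w, symmetric] complex_norm_square[symmetric])
  then show ?thesis by (simp add: quot_form_def)
qed

lemma quot_form_psd: "psd_form (quot_form h w)"
proof
  fix x y z t
  show "quot_form h w (\<lambda>k. x k + t * y k) z = quot_form h w x z + t * quot_form h w y z"
    by (simp add: quot_form_def linear_left algebra_simps add_divide_distrib)
  show "cnj (quot_form h w x y) = quot_form h w y x"
    by (simp add: quot_form_def hermitian)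
  show "0 \<le> Re (quot_form h w x x)"
  proof (cases "h w w = 0")
    case True then show ?thesis using nonneg by (simp add: quot_form_def)
  next
    case False
    define t where "t = - h x w / h w w"
    have "h (\<lambda>k. x k + t * w k) (\<lambda>k. x k + t * w k) 
        = h x x + cnj t * h x w + t * (h w x + cnj t * h w w)"
      by (simp add: linear_left linear_right algebra_simps)
    also have "cnj t * h w w = - h w x" using False by (simp add: t_def hermitian)
    also have "cnj t = - h w x / h w w" by (simp add: t_def hermitian)
    finally have "quot_form h w x x = h (\<lambda>k. x k + t * w k) (\<lambda>k. x k + t * w k)"
      by (simp add: quot_form_def)
    then show ?thesis using nonneg by simp
  qed
qed

lemma quot_form_null: "quot_form h w w w = 0"
  by (simp add: quot_form_def)

lemma quot_form_null_mono:
  assumes "h x x = 0" shows "quot_form h w x x = 0"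
  using null_left[OF assms] by (simp add: quot_form_def)

end

section \<open>Energy input into one coordinate of a contraction\<close>

text \<open>Here \<open>l\<close> is a diagonal entry, \<open>p\<close> the input from the later
  coordinates, and \<open>D\<close> the energy that these lose. The best choice of \<open>s\<close>
  gives \<open>(cmod p)\<^sup>2 \<le> (1 - (cmod l)\<^sup>2) * D\<close>: a weakly damped coordinate
  receives little. This is why the constant 2 does not depend on \<open>d\<close>.\<close>

lemma contraction_row_bound:
  fixes p l y :: complex and D d :: real
  assumes contr: "\<And>s. (cmod (p + s * l))\<^sup>2 \<le> D + (cmod s)\<^sup>2"
    and l: "(cmod l)\<^sup>2 \<le> 1 - d" and d: "0 < d"
  shows "(cmod (p + y * l))\<^sup>2 \<le> (1 - d / 2) * (cmod y)\<^sup>2 + 2 * D"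
proof -
  define a where "a = cmod l"
  define e where "e = 1 - a\<^sup>2"
  have e: "d \<le> e" "0 < e" "e \<le> 1" using l d by (auto simp: e_def a_def)
  \<comment> \<open>the maximizer of \<open>(cmod (p + s * l))\<^sup>2 - (cmod s)\<^sup>2\<close>\<close>
  define s where "s = p * cnj l / of_real e"
  have "s * l = p * of_real (a\<^sup>2 / e)"
    by (simp add: s_def a_def complex_norm_square[symmetric] mult.commute[of "cnj l"] flip: of_real_power)
  then have "p + s * l = p * of_real (1 + a\<^sup>2 / e)"
    by (simp add: algebra_simps)
  also have "1 + a\<^sup>2 / e = 1 / e"
    using e by (simp add: e_def field_simps)
  finally have "p + s * l = p * of_real (1 / e)" .
  then have "(cmod (p + s * l))\<^sup>2 = (cmod p)\<^sup>2 / e\<^sup>2"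
    using e by (simp add: norm_mult norm_divide power_mult_distrib power_divide)
  moreover have "(cmod s)\<^sup>2 = (cmod p)\<^sup>2 * a\<^sup>2 / e\<^sup>2"
    by (simp add: s_def a_def norm_mult norm_divide power_mult_distrib power_divide)
  ultimately have "(cmod p)\<^sup>2 / e\<^sup>2 \<le> D + (cmod p)\<^sup>2 * a\<^sup>2 / e\<^sup>2"
    using contr[of s] by simp
  moreover have "(cmod p)\<^sup>2 / e\<^sup>2 * e = (cmod p)\<^sup>2 / e\<^sup>2 - (cmod p)\<^sup>2 * a\<^sup>2 / e\<^sup>2"
    unfolding e_def by (simp add: right_diff_distrib)
  ultimately have "(cmod p)\<^sup>2 / e\<^sup>2 * e \<le> D" by linarith
  then have p: "(cmod p)\<^sup>2 \<le> e * D" using e by (simp add: power2_eq_square field_simps)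
  define r where "r = 1 - d / 2"
  define b where "b = cmod y"
  define c where "c = cmod p"
  \<comment> \<open>Completing the square costs a factor \<open>1 / q\<close>. As \<open>q\<close>
    is at least \<open>e / 2\<close>, the bound \<open>e * D\<close> on \<open>c\<^sup>2\<close>
    turns this into \<open>2 * D\<close>.\<close>
  define q where "q = r - a\<^sup>2"
  have q: "q \<ge> e / 2" "q > 0" using e by (auto simp: q_def r_def e_def)
  have D: "0 \<le> D" using p e by (metis zero_le_power2 order_trans zero_le_mult_iff not_le)
  have "cmod (p + y * l) \<le> a * b + c"
    using norm_triangle_ineq[of p "y * l"] by (simp add: norm_mult a_def b_def c_def mult.commute)
  then have "(cmod (p + y * l))\<^sup>2 \<le> (a * b + c)\<^sup>2" by (intro power_mono) auto
  also have "\<dots> = r * b\<^sup>2 + r * c\<^sup>2 / q - (q * b - a * c)\<^sup>2 / q"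
  proof -
    have "r = a\<^sup>2 + q" by (simp add: q_def)
    then show ?thesis using q(2) by (simp add: field_simps power2_eq_square)
  qed
  also have "\<dots> \<le> r * b\<^sup>2 + r * c\<^sup>2 / q" using q by simp
  also have "r * c\<^sup>2 / q \<le> 1 * (e * D) / q"
    using p q e d D by (intro divide_right_mono mult_mono) (auto simp: r_def c_def)
  also have "\<dots> \<le> 2 * D"
    using q D mult_right_mono[OF q(1) D] by (simp add: field_simps)
  finally show ?thesis by (simp add: r_def b_def)
qed

text \<open>Modulo null vectors \<open>w\<close> is an eigenvector, so \<open>T\<close> acts on the
  quotient. All representatives \<open>x' + s * w\<close> of a class have the same quotient energies
  before and after \<open>T\<close>, but contractivity can be tested at each of them:
  \<open>s = 0\<close> gives the first claim, and all \<open>s\<close> together supply the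
  hypothesis of \<open>contraction_row_bound\<close> for the second.\<close>

lemma (in psd_form) quot_form_contraction:
  assumes lin: "\<And>x y t. T (\<lambda>k. x k + t * y k) = (\<lambda>k. T x k + t * T y k)"
    and contr: "\<And>x. Re (h (T x) (T x)) \<le> Re (h x x)"
    and eig: "h (\<lambda>k. T w k - l * w k) (\<lambda>k. T w k - l * w k) = 0"
  shows "Re (quot_form h w (T x) (T x)) \<le> Re (quot_form h w x x)"
    and "(cmod l)\<^sup>2 \<le> 1 - d \<Longrightarrow> 0 < d \<Longrightarrow> 
      (cmod (h (T x) w))\<^sup>2 / Re (h w w) \<le> (1 - d / 2) * ((cmod (h x w))\<^sup>2 / Re (h w w))
        + 2 * (Re (quot_form h w x x) - Re (quot_form h w (T x) (T x)))"
proof -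
  define g where "g = quot_form h w"
  interpret g: psd_form g unfolding g_def by (rule quot_form_psd)
  define m where "m = Re (h w w)"
  have hm: "h w w = of_real m" unfolding m_def by (rule self_real)
  have gw: "g w w = 0" unfolding g_def by (rule quot_form_null)
  have hz: "h (\<lambda>k. T w k - l * w k) z = 0" for z by (rule null_left[OF eig])
  have hTw: "h (T w) z = l * h w z" for z
    using hz[of z] linear_left[of "T w" "-l" w z] by simp
  have gTw: "g (T w) (T w) = 0"
    using null_left[of w "T w"] by (cases "h w w = 0") (simp_all add: g_def quot_form_def hTw)
  \<comment> \<open>For \<open>m \<noteq> 0\<close>, \<open>x'\<close> is the part of
    \<open>x\<close> orthogonal to \<open>w\<close>, \<open>t\<close> the coefficient of
    \<open>x\<close> along \<open>w\<close>, and \<open>p\<close> that of \<open>T x'\<close>. The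
    coefficient of \<open>T x\<close> is then \<open>p + t * l\<close>.\<close>
  define t where "t = h x w / h w w"
  define x' where "x' = (\<lambda>k. x k + (- t) * w k)"
  define p where "p = h (T x') w / h w w"
  have Tadd: "T (\<lambda>k. x' k + s * w k) = (\<lambda>k. T x' k + s * T w k)" for s by (rule lin)
  have gx': "g x' x' = g x x" unfolding x'_def by (rule g.null_shift[OF gw])
  have xx': "x = (\<lambda>k. x' k + t * w k)" by (simp add: x'_def)
  have gTx: "g (T (\<lambda>k. x' k + s * w k)) (T (\<lambda>k. x' k + s * w k)) = g (T x') (T x')" for s
    unfolding Tadd by (rule g.null_shift[OF gTw])
  have gT: "g (T x) (T x) = g (T x') (T x')"
    using gTx[of t] by (simp flip: xx')
  define D where "D = Re (g x x) - Re (g (T x) (T x))"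
  have self: "Re (h z z) = Re (g z z) + (cmod (h z w))\<^sup>2 / m" for z
    by (simp add: g_def m_def quot_form_self)
  have *: "0 \<le> D \<and> ((cmod l)\<^sup>2 \<le> 1 - d \<longrightarrow> 0 < d \<longrightarrow> 
      (cmod (h (T x) w))\<^sup>2 / m \<le> (1 - d / 2) * ((cmod (h x w))\<^sup>2 / m) + 2 * D)" for d
  proof (cases "m = 0")
    case True
    \<comment> \<open>Division by zero makes all terms along \<open>w\<close> vanish, so both claims
      reduce to this one.\<close>
    then have "D \<ge> 0" using contr[of x] self[of x] self[of "T x"] by (simp add: D_def)
    then show ?thesis using True by simp
  next
    case False
    then have m: "m > 0" using nonneg[of w] by (simp add: m_def)
    have "h x' w = h x w + - t * h w w" unfolding x'_def by (rule linear_left)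
    then have hx'w: "h x' w = 0" using m by (simp add: t_def hm)
    have hs: "(cmod (h (T (\<lambda>k. x' k + s * w k)) w))\<^sup>2 / m = m * (cmod (p + s * l))\<^sup>2" for s
    proof -
      have "h (T (\<lambda>k. x' k + s * w k)) w = of_real m * (p + s * l)"
        using m by (simp add: Tadd linear_left hTw p_def hm algebra_simps)
      then show ?thesis using m
        by (simp add: norm_mult power_mult_distrib power2_eq_square)
    qed
    have hxs: "(cmod (h (\<lambda>k. x' k + s * w k) w))\<^sup>2 / m = m * (cmod s)\<^sup>2" for s
      using m by (simp add: linear_left hx'w hm norm_mult power_mult_distrib power2_eq_square)
    have gxs: "g (\<lambda>k. x' k + s * w k) (\<lambda>k. x' k + s * w k) = g x x" for s
      using g.null_shift[OF gw] gx' by simp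
    have mc: "m * (cmod (p + s * l))\<^sup>2 \<le> D + m * (cmod s)\<^sup>2" for s
      using contr[of "\<lambda>k. x' k + s * w k"]
      unfolding self hs hxs gxs gTx by (simp add: D_def gT)
    have c: "(cmod (p + s * l))\<^sup>2 \<le> D / m + (cmod s)\<^sup>2" for s
      using mc[of s] m by (simp add: field_simps)
    have "0 \<le> D / m" using c[of 0] by (smt (verit) zero_le_power2 norm_zero power_zero_numeral)
    then have D: "0 \<le> D" using m by (simp add: zero_le_divide_iff)
    have "(cmod (h (T x) w))\<^sup>2 / m \<le> (1 - d / 2) * ((cmod (h x w))\<^sup>2 / m) + 2 * D"
      if d: "(cmod l)\<^sup>2 \<le> 1 - d" "0 < d"
    proof -
      have "(cmod (h (T x) w))\<^sup>2 / m = m * (cmod (p + t * l))\<^sup>2"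
        using hs[of t] by (simp flip: xx')
      also have "\<dots> \<le> m * ((1 - d / 2) * (cmod t)\<^sup>2 + 2 * (D / m))"
        using contraction_row_bound[OF c d] m by (intro mult_left_mono) auto
      also have "\<dots> = (1 - d / 2) * (m * (cmod t)\<^sup>2) + 2 * D"
        using m by (simp add: algebra_simps)
      also have "m * (cmod t)\<^sup>2 = (cmod (h x w))\<^sup>2 / m" using hxs[of t] by (simp flip: xx')
      finally show ?thesis .
    qed
    then show ?thesis using D by blast
  qed
  show "Re (quot_form h w (T x) (T x)) \<le> Re (quot_form h w x x)"
    using * by (simp add: D_def g_def)
  show "(cmod l)\<^sup>2 \<le> 1 - d \<Longrightarrow> 0 < d \<Longrightarrow> 
      (cmod (h (T x) w))\<^sup>2 / Re (h w w) \<le> (1 - d / 2) * ((cmod (h x w))\<^sup>2 / Re (h w w))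
        + 2 * (Re (quot_form h w x x) - Re (quot_form h w (T x) (T x)))"
    using *[of d] by (simp add: D_def g_def m_def)
qed

section \<open>Lyapunov function of a triangular contraction\<close>

text \<open>The state after dividing out the first \<open>i\<close> basis vectors. Indices from
  \<open>n\<close> on are null as well, so that functions on all of \<open>nat\<close> can stand for
  vectors of length \<open>n\<close>.\<close>

definition flag_null :: "((nat \<Rightarrow> complex) \<Rightarrow> (nat \<Rightarrow> complex) \<Rightarrow> complex) \<Rightarrow> nat \<Rightarrow> nat \<Rightarrow> bool" where
  "flag_null h i n \<longleftrightarrow> (\<forall>x. (\<forall>j\<in>{i..<n}. x j = 0) \<longrightarrow> h x x = 0)"

text \<open>Subtracting \<open>x i * w\<close> clears coordinate \<open>i\<close> and leaves an
  \<open>h\<close>-null vector; the quotient form cannot see the subtracted multiple of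
  \<open>w\<close>.\<close>

lemma flag_null_quot_form:
  fixes h :: "(nat \<Rightarrow> complex) \<Rightarrow> (nat \<Rightarrow> complex) \<Rightarrow> complex"
  assumes "psd_form h" and fl: "flag_null h i n" and w: "w i = 1" and w0: "\<And>j. j \<in> {Suc i..<n} \<Longrightarrow> w j = 0"
  shows "flag_null (quot_form h w) (Suc i) n"
  unfolding flag_null_def
proof (intro allI impI)
  interpret psd_form h by fact
  interpret g: psd_form "quot_form h w" by (rule quot_form_psd)
  fix x :: "nat \<Rightarrow> complex" assume x: "\<forall>j\<in>{Suc i..<n}. x j = 0"
  have "h (\<lambda>k. x k + (- x i) * w k) (\<lambda>k. x k + (- x i) * w k) = 0"
  proof -
    have "x j + - x i * w j = 0" if "j \<in> {i..<n}" for j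
    proof (cases "j = i")
      case True then show ?thesis by (simp add: w)
    next
      case False
      then have "j \<in> {Suc i..<n}" using that by simp
      then show ?thesis using x w0 by simp
    qed
    then show ?thesis by (intro fl[unfolded flag_null_def, rule_format])
  qed
  then have "quot_form h w (\<lambda>k. x k + (- x i) * w k) (\<lambda>k. x k + (- x i) * w k) = 0"
    by (rule quot_form_null_mono)
  then show "quot_form h w x x = 0"
    using g.null_shift[OF quot_form_null, of x "- x i"] by simp
qed

definition unit_fun where "unit_fun i = (\<lambda>k::nat. if k = i then 1 else (0::complex))"

text \<open>The constant \<open>3 ^ (n - i0)\<close> is independent of \<open>d\<close>, so the dimension enters the mixing time
  only additively; power bounds from triangularity alone lose a factor \<open>1 / d\<close> per dimension.\<close>

lemma triangular_contraction_lyapunov: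
  fixes h :: "(nat \<Rightarrow> complex) \<Rightarrow> (nat \<Rightarrow> complex) \<Rightarrow> complex"
  assumes "psd_form h"
    and lin: "\<And>x y t. T (\<lambda>k. x k + t * y k) = (\<lambda>k. T x k + t * T y k)"
    and contr: "\<And>x. Re (h (T x) (T x)) \<le> Re (h x x)"
    and tri: "\<And>i j. i < j \<Longrightarrow> j < n \<Longrightarrow> T (unit_fun i) j = 0"
    and diag: "\<And>i. i0 \<le> i \<Longrightarrow> i < n \<Longrightarrow> (cmod (T (unit_fun i) i))\<^sup>2 \<le> 1 - d"
    and d: "0 < d" and fl: "flag_null h i0 n" and "i0 \<le> n"
  shows "\<exists>V. \<forall>x. Re (h x x) \<le> V x \<and> V x \<le> (3 ^ (n - i0) - 1) * Re (h x x)
     \<and> V (T x) \<le> (1 - d / 4) * V x - d / 4 * Re (h x x)"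
  using \<open>i0 \<le> n\<close> \<open>psd_form h\<close> contr diag fl
proof (induction i0 arbitrary: h rule: inc_induct)
  case base
  then have "h x x = 0" for x by (simp add: flag_null_def)
  then show ?case by (intro exI[of _ "\<lambda>_. 0"]) auto
next
  case (step i)
  interpret psd_form h by (rule step.prems)
  define w where "w = unit_fun i"
  define l where "l = T w i"
  define g where "g = quot_form h w"
  \<comment> \<open>\<open>T w\<close> may have entries at indices below \<open>i\<close>, but these
    are null by now, so \<open>w\<close> is an eigenvector modulo null vectors.\<close>
  have eig: "h (\<lambda>k. T w k - l * w k) (\<lambda>k. T w k - l * w k) = 0"
  proof -
    have "T w j - l * w j = 0" if "j \<in> {i..<n}" for j
      using tri[of i j] that by (cases "j = i") (auto simp: w_def l_def unit_fun_def)
    then show ?thesis using step.prems(4) by (simp add: flag_null_def)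
  qed
  have gpsd: "psd_form g" unfolding g_def by (rule quot_form_psd)
  interpret g: psd_form g by (rule gpsd)
  have gcontr: "Re (g (T x) (T x)) \<le> Re (g x x)" for x
    unfolding g_def by (rule quot_form_contraction(1)[OF lin step.prems(2) eig])
  have "flag_null g (Suc i) n" unfolding g_def
    by (rule flag_null_quot_form[OF step.prems(1,4)]) (auto simp: w_def unit_fun_def)
  from step.IH[OF gpsd gcontr step.prems(3) this] obtain V where
    V1: "\<And>x. Re (g x x) \<le> V x" and
    V2: "\<And>x. V x \<le> (3 ^ (n - Suc i) - 1) * Re (g x x)" and
    V3: "\<And>x. V (T x) \<le> (1 - d / 4) * V x - d / 4 * Re (g x x)"
    by auto
  define Y where "Y = (\<lambda>x. (cmod (h x w))\<^sup>2 / Re (h w w))"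
  define C :: real where "C = 3 ^ (n - Suc i)"
  have C: "C \<ge> 1" "3 ^ (n - i) = 3 * C"
    using step.hyps by (auto simp: C_def simp flip: power_Suc Suc_diff_Suc)
  have hYg: "Re (h x x) = Y x + Re (g x x)" for x
    by (simp add: Y_def g_def quot_form_self)
  have Y0: "0 \<le> Y x" for x using nonneg[of w] by (simp add: Y_def)
  have l: "(cmod l)\<^sup>2 \<le> 1 - d" using step by (simp add: l_def w_def)
  have Yx: "Y (T x) \<le> (1 - d / 2) * Y x + 2 * (Re (g x x) - Re (g (T x) (T x)))" for x
    unfolding Y_def g_def by (rule quot_form_contraction(2)[OF lin step.prems(2) eig l d])
  \<comment> \<open>The multiple of \<open>g\<close> absorbs the coupling of the coordinate along \<open>w\<close> to the others;
      the surplus \<open>d / 4 * g\<close> in \<open>V3\<close> pays for it, which is why the induction hypothesis carries that term.\<close>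
  define W where "W = (\<lambda>x. Y x + 2 * Re (g x x) + 3 * V x)"
  have "Re (h x x) \<le> W x" for x
    using V1[of x] g.nonneg[of x] by (simp add: W_def hYg)
  \<comment> \<open>The identity \<open>2 + 3 * (C - 1) = 3 * C - 1\<close> is the reason for the
    form \<open>3 ^ m - 1\<close> of the upper bound.\<close>
  moreover have "W x \<le> (3 * C - 1) * Re (h x x)" for x
  proof -
    have "W x \<le> Y x + (3 * C - 1) * Re (g x x)"
      using V2[of x] by (simp add: W_def C_def[symmetric] algebra_simps)
    also have "\<dots> \<le> (3 * C - 1) * Y x + (3 * C - 1) * Re (g x x)"
      using mult_right_mono[of 1 "3 * C - 1" "Y x"] C Y0[of x] by simp
    finally show ?thesis by (simp add: hYg algebra_simps)
  qed
  \<comment> \<open>The terms in \<open>g\<close> balance exactly: three times the surplus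
    \<open>d / 4\<close> covers the decay \<open>2 * (d / 4)\<close> demanded of
    \<open>2 * g\<close> and the new surplus \<open>d / 4\<close>.\<close>
  moreover have "W (T x) \<le> (1 - d / 4) * W x - d / 4 * Re (h x x)" for x
    using Yx[of x] V3[of x] by (simp add: W_def hYg algebra_simps)
  ultimately show ?case unfolding C by blast
qed

section \<open>Lazy Perron-Frobenius matrices\<close>

lemma weighted_Cauchy_Schwarz:
  fixes r v b :: "'i \<Rightarrow> real"
  assumes "\<And>j. j \<in> S \<Longrightarrow> 0 \<le> r j" and "\<And>j. j \<in> S \<Longrightarrow> 0 < v j"
  shows "(\<Sum>j\<in>S. r j * b j)\<^sup>2 \<le> (\<Sum>j\<in>S. r j * v j) * (\<Sum>j\<in>S. r j * (b j)\<^sup>2 / v j)"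
proof -
  have "(\<Sum>j\<in>S. r j * b j)\<^sup>2 = (\<Sum>j\<in>S. sqrt (r j * v j) * (sqrt (r j / v j) * b j))\<^sup>2"
    using assms by (intro arg_cong[where f = "\<lambda>x. x\<^sup>2"] sum.cong refl)
      (simp add: real_sqrt_mult real_sqrt_divide less_imp_le less_imp_neq[symmetric])
  also have "\<dots> \<le> (\<Sum>j\<in>S. (sqrt (r j * v j))\<^sup>2) * (\<Sum>j\<in>S. (sqrt (r j / v j) * b j)\<^sup>2)"
    by (rule Cauchy_Schwarz_ineq_sum)
  also have "(\<Sum>j\<in>S. (sqrt (r j * v j))\<^sup>2) = (\<Sum>j\<in>S. r j * v j)"
    using assms by (intro sum.cong refl) (simp add: less_imp_le)
  also have "(\<Sum>j\<in>S. (sqrt (r j / v j) * b j)\<^sup>2) = (\<Sum>j\<in>S. r j * (b j)\<^sup>2 / v j)"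
    using assms by (intro sum.cong refl) (simp add: power_mult_distrib less_imp_le)
  finally show ?thesis .
qed

text \<open>Rescaling by \<open>v\<close> turns \<open>r\<close> into the stochastic matrix with
  entries \<open>r i j * v j / v i\<close>, whose stationary distribution is proportional to
  \<open>u i * v i\<close>. The weighted norm is the corresponding L2 norm of \<open>x / v\<close>,
  and the claim is Jensen's inequality for it.\<close>

lemma weighted_norm_contraction:
  fixes r :: "'i \<Rightarrow> 'i \<Rightarrow> real" and x :: "'i \<Rightarrow> complex"
  assumes r: "\<And>i j. i \<in> S \<Longrightarrow> j \<in> S \<Longrightarrow> 0 \<le> r i j"
    and u: "\<And>i. i \<in> S \<Longrightarrow> 0 < u i" and v: "\<And>i. i \<in> S \<Longrightarrow> 0 < v i"
    and rv: "\<And>i. i \<in> S \<Longrightarrow> (\<Sum>j\<in>S. r i j * v j) = v i"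
    and ru: "\<And>j. j \<in> S \<Longrightarrow> (\<Sum>i\<in>S. r i j * u i) = u j"
  shows "(\<Sum>i\<in>S. u i / v i * (cmod (\<Sum>j\<in>S. of_real (r i j) * x j))\<^sup>2)
       \<le> (\<Sum>i\<in>S. u i / v i * (cmod (x i))\<^sup>2)"
proof -
  have "(\<Sum>i\<in>S. u i / v i * (cmod (\<Sum>j\<in>S. of_real (r i j) * x j))\<^sup>2)
      \<le> (\<Sum>i\<in>S. u i / v i * (v i * (\<Sum>j\<in>S. r i j * (cmod (x j))\<^sup>2 / v j)))"
  proof (intro sum_mono mult_left_mono)
    fix i assume i: "i \<in> S"
    have "cmod (\<Sum>j\<in>S. of_real (r i j) * x j) \<le> (\<Sum>j\<in>S. r i j * cmod (x j))"
      using r[OF i] by (intro sum_norm_le) (simp add: norm_mult)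
    then have "(cmod (\<Sum>j\<in>S. of_real (r i j) * x j))\<^sup>2 \<le> (\<Sum>j\<in>S. r i j * cmod (x j))\<^sup>2"
      by (intro power_mono) auto
    also have "\<dots> \<le> (\<Sum>j\<in>S. r i j * v j) * (\<Sum>j\<in>S. r i j * (cmod (x j))\<^sup>2 / v j)"
      by (rule weighted_Cauchy_Schwarz) (use r i v in auto)
    finally show "(cmod (\<Sum>j\<in>S. of_real (r i j) * x j))\<^sup>2 \<le> v i * (\<Sum>j\<in>S. r i j * (cmod (x j))\<^sup>2 / v j)"
      by (simp add: rv i)
    show "0 \<le> u i / v i" using u v i by (simp add: less_imp_le)
  qed
  also have "\<dots> = (\<Sum>i\<in>S. \<Sum>j\<in>S. r i j * u i * ((cmod (x j))\<^sup>2 / v j))"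
    using v by (intro sum.cong refl) (simp add: sum_distrib_left less_imp_neq[symmetric] mult_ac)
  also have "\<dots> = (\<Sum>j\<in>S. (\<Sum>i\<in>S. r i j * u i) * ((cmod (x j))\<^sup>2 / v j))"
    by (subst sum.swap) (simp only: sum_distrib_right)
  also have "\<dots> = (\<Sum>i\<in>S. u i / v i * (cmod (x i))\<^sup>2)"
    by (intro sum.cong refl) (simp add: ru)
  finally show ?thesis .
qed

lemma mult_mat_vec_index:
  assumes "A \<in> carrier_mat n n" "dim_vec x = n" "i < n"
  shows "(A *\<^sub>v x) $ i = (\<Sum>j<n. A $$ (i,j) * x $ j)"
  using assms by (simp add: scalar_prod_def atLeast0LessThan)

lemma mult_mat_mat_index:
  assumes "A \<in> carrier_mat n n" "B \<in> carrier_mat n n" "i < n" "j < n"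
  shows "(A * B) $$ (i,j) = (\<Sum>k<n. A $$ (i,k) * B $$ (k,j))"
  using assms by (simp add: scalar_prod_def atLeast0LessThan)

text \<open>The diagonal follows the order of \<open>es\<close>; this allows the eigenvalue 1 to be
  placed first.\<close>

lemma schur_triangularization:
  fixes A :: "complex mat"
  assumes A: "A \<in> carrier_mat n n" and cp: "char_poly A = (\<Prod>e\<leftarrow>es. [:- e, 1:])"
  obtains B P Q where "B \<in> carrier_mat n n" "P \<in> carrier_mat n n" "Q \<in> carrier_mat n n"
    "P * Q = 1\<^sub>m n" "Q * P = 1\<^sub>m n" "A * P = P * B" "upper_triangular B"
    "length es = n" "\<forall>i<n. B $$ (i,i) = es ! i"
proof -
  obtain B P Q where "schur_decomposition A es = (B, P, Q)" by (metis prod_cases3)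
  from schur_decomposition[OF A cp this]
  have sim: "similar_mat_wit A B P Q" and tri: "upper_triangular B" and diag: "diag_mat B = es"
    by auto
  note S = similar_mat_witD2[OF A sim]
  have "A * P = P * B * (Q * P)"
    using assoc_mult_mat[of "P * B" n n Q n P n] S by simp
  then have "A * P = P * B" using S by simp
  moreover have "length es = n" "\<forall>i<n. B $$ (i,i) = es ! i"
    using diag S(5) by (auto simp: diag_mat_def)
  ultimately show ?thesis using that S tri by blast
qed

locale pf_matrix =
  fixes n :: nat and R :: "real mat" and u v :: "real vec"
  assumes R: "R \<in> carrier_mat n n" and nonneg: "nonneg_mat R" and irred: "irreducible_mat R"
    and lazy: "half_lazy R"
    and u: "u \<in> carrier_vec n" and v: "v \<in> carrier_vec n"
    and u_pos: "\<And>i. i < n \<Longrightarrow> 0 < u $ i" and v_pos: "\<And>i. i < n \<Longrightarrow> 0 < v $ i"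
    and left: "transpose_mat R *\<^sub>v u = u" and right: "R *\<^sub>v v = v" and norm: "u \<bullet> v = 1"
begin

abbreviation A where "A \<equiv> map_mat complex_of_real R"

lemma A: "A \<in> carrier_mat n n" using R by simp

lemma A_index: "i < n \<Longrightarrow> j < n \<Longrightarrow> A $$ (i,j) = of_real (R $$ (i,j))" using R by simp

lemma R_nonneg: "i < n \<Longrightarrow> j < n \<Longrightarrow> 0 \<le> R $$ (i,j)"
  using nonneg R by (auto simp: nonneg_mat_def)

lemma R_diag: "i < n \<Longrightarrow> 1 / 2 \<le> R $$ (i,i)"
  using lazy R by (auto simp: half_lazy_def)

lemma row_sum: "i < n \<Longrightarrow> (\<Sum>j<n. R $$ (i,j) * v $ j) = v $ i"
  using mult_mat_vec_index[of R n v i] R v right by simp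

lemma col_sum:
  assumes "j < n" shows "(\<Sum>i<n. R $$ (i,j) * u $ i) = u $ j"
proof -
  have "u $ j = (\<Sum>i<n. transpose_mat R $$ (j,i) * u $ i)"
    using mult_mat_vec_index[of "transpose_mat R" n u j] R u assms left by simp
  also have "\<dots> = (\<Sum>i<n. R $$ (i,j) * u $ i)"
    using R assms by (intro sum.cong refl) simp
  finally show ?thesis by simp
qed

lemma uv_sum: "(\<Sum>i<n. u $ i * v $ i) = 1"
  using norm u v by (simp add: scalar_prod_def atLeast0LessThan)

lemma n_pos: "0 < n" using uv_sum by (cases n) auto

lemma left_eigen:
  fixes z :: "complex vec"
  assumes "z \<in> carrier_vec n"
  shows "(\<Sum>i<n. of_real (u $ i) * (A *\<^sub>v z) $ i) = (\<Sum>i<n. of_real (u $ i) * z $ i)"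
proof -
  have "(\<Sum>i<n. of_real (u $ i) * (A *\<^sub>v z) $ i)
      = (\<Sum>i<n. \<Sum>j<n. of_real (R $$ (i,j) * u $ i) * z $ j)"
    using assms by (intro sum.cong refl)
      (simp add: mult_mat_vec_index[OF A] A_index sum_distrib_left mult_ac del: index_mult_mat_vec)
  also have "\<dots> = (\<Sum>j<n. of_real (\<Sum>i<n. R $$ (i,j) * u $ i) * z $ j)"
    by (subst sum.swap) (simp add: sum_distrib_right)
  finally show ?thesis by (simp add: col_sum)
qed

lemma contraction:
  fixes z :: "complex vec"
  assumes "z \<in> carrier_vec n"
  shows "(\<Sum>i<n. u $ i / v $ i * (cmod ((A *\<^sub>v z) $ i))\<^sup>2) \<le> (\<Sum>i<n. u $ i / v $ i * (cmod (z $ i))\<^sup>2)"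
proof -
  have "(A *\<^sub>v z) $ i = (\<Sum>j<n. of_real (R $$ (i,j)) * z $ j)" if "i < n" for i
    using assms that by (simp add: mult_mat_vec_index[OF A] A_index del: index_mult_mat_vec)
  then show ?thesis
    using weighted_norm_contraction[of "{..<n}" "\<lambda>i j. R $$ (i,j)" "($) u" "($) v" "($) z"]
    by (simp add: R_nonneg u_pos v_pos row_sum col_sum)
qed

text \<open>Laziness makes \<open>2R - I\<close> a nonnegative matrix with the same Perron vectors,
  hence a contraction as well.\<close>

lemma eigenvalue_disc:
  assumes "eigenvalue A l"
  shows "(cmod l)\<^sup>2 \<le> Re l"
proof -
  obtain z where z: "z \<in> carrier_vec n" "z \<noteq> 0\<^sub>v n" "A *\<^sub>v z = l \<cdot>\<^sub>v z"
    using assms A by (auto simp: eigenvalue_def eigenvector_def)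
  define r where "r = (\<lambda>i j. 2 * R $$ (i,j) - (if i = j then 1 else 0))"
  define H where "H = (\<Sum>i<n. u $ i / v $ i * (cmod (z $ i))\<^sup>2)"
  have rz: "(\<Sum>j<n. of_real (r i j) * z $ j) = (2 * l - 1) * z $ i" if i: "i < n" for i
  proof -
    have "(\<Sum>j<n. of_real (r i j) * z $ j)
        = (\<Sum>j<n. 2 * (of_real (R $$ (i,j)) * z $ j) - (if i = j then z $ j else 0))"
      by (intro sum.cong refl) (simp add: r_def algebra_simps)
    also have "\<dots> = 2 * (\<Sum>j<n. of_real (R $$ (i,j)) * z $ j) - z $ i"
      using i by (simp add: sum_subtractf sum_distrib_left)
    also have "(\<Sum>j<n. of_real (R $$ (i,j)) * z $ j) = (A *\<^sub>v z) $ i"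
      using i z(1) by (simp add: mult_mat_vec_index[OF A] A_index del: index_mult_mat_vec)
    also have "\<dots> = l * z $ i" using i z by simp
    finally show ?thesis by (simp add: algebra_simps)
  qed
  have "(\<Sum>i<n. u $ i / v $ i * (cmod (\<Sum>j<n. of_real (r i j) * z $ j))\<^sup>2) \<le> H"
    unfolding H_def
  proof (rule weighted_norm_contraction)
    fix i j assume ij: "i \<in> {..<n}" "j \<in> {..<n}"
    show "0 \<le> r i j" using ij R_nonneg[of i j] R_diag[of i] by (auto simp: r_def)
    show "(\<Sum>j<n. r i j * v $ j) = v $ i"
    proof -
      have "(\<Sum>j<n. r i j * v $ j) = (\<Sum>j<n. 2 * (R $$ (i,j) * v $ j) - (if i = j then v $ j else 0))"
        by (intro sum.cong refl) (simp add: r_def algebra_simps)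
      then show ?thesis using ij by (simp add: sum_subtractf row_sum flip: sum_distrib_left)
    qed
    show "(\<Sum>i<n. r i j * u $ i) = u $ j"
    proof -
      have "(\<Sum>i<n. r i j * u $ i) = (\<Sum>i<n. 2 * (R $$ (i,j) * u $ i) - (if i = j then u $ i else 0))"
        by (intro sum.cong refl) (simp add: r_def algebra_simps)
      then show ?thesis using ij by (simp add: sum_subtractf col_sum flip: sum_distrib_left)
    qed
  qed (auto simp: u_pos v_pos)
  moreover have "(\<Sum>i<n. u $ i / v $ i * (cmod (\<Sum>j<n. of_real (r i j) * z $ j))\<^sup>2) = (cmod (2 * l - 1))\<^sup>2 * H"
    unfolding H_def sum_distrib_left
    by (intro sum.cong refl) (simp add: rz norm_mult power_mult_distrib)
  ultimately have "(cmod (2 * l - 1))\<^sup>2 * H \<le> 1 * H" by simp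
  moreover have "H > 0"
  proof -
    obtain k where k: "k < n" "z $ k \<noteq> 0"
      using z(1,2) by (auto simp: vec_eq_iff)
    have "0 < u $ k / v $ k * (cmod (z $ k))\<^sup>2" using k u_pos v_pos by simp
    also have "\<dots> \<le> H" unfolding H_def
      using k u_pos v_pos by (intro member_le_sum) (auto simp: less_imp_le)
    finally show ?thesis .
  qed
  ultimately have "(cmod (2 * l - 1))\<^sup>2 \<le> 1" by simp
  \<comment> \<open>The disc whose diameter is the segment from 0 to 1; multiplied out, it is the
    claim.\<close>
  then have "(2 * Re l - 1)\<^sup>2 + (2 * Im l)\<^sup>2 \<le> 1" by (simp add: cmod_power2)
  then show ?thesis by (simp add: cmod_power2) (simp add: power2_eq_square algebra_simps)
qed

section \<open>Simplicity of the eigenvalue 1\<close>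

lemma pow_fixed:
  assumes "y \<in> carrier_vec n" "R *\<^sub>v y = y"
  shows "(R ^\<^sub>m k) *\<^sub>v y = y"
  using assms R by (induction k) (simp_all add: assoc_mult_mat_vec[of _ n n _ n])

lemma pow_nonneg: "i < n \<Longrightarrow> j < n \<Longrightarrow> 0 \<le> (R ^\<^sub>m k) $$ (i,j)"
proof (induction k arbitrary: j)
  case (Suc k)
  have "(R ^\<^sub>m Suc k) $$ (i,j) = (\<Sum>m<n. (R ^\<^sub>m k) $$ (i,m) * R $$ (m,j))"
    using mult_mat_mat_index[of "R ^\<^sub>m k" n R i j] Suc.prems R by simp
  then show ?case using Suc by (auto intro!: sum_nonneg simp: R_nonneg)
qed (use R in \<open>auto simp: one_mat_def\<close>)

text \<open>Minimum principle: subtracting the largest multiple of \<open>v\<close> that lies below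
  \<open>x\<close> leaves a nonnegative fixed vector \<open>y\<close> with a zero at some
  \<open>s\<close>. By irreducibility some power of \<open>R\<close> has a positive entry at
  \<open>(s,i)\<close>, which carries the zero to every \<open>i\<close>.\<close>

lemma real_fixed_vec:
  assumes x: "x \<in> carrier_vec n" "R *\<^sub>v x = x"
  obtains t where "\<And>i. i < n \<Longrightarrow> x $ i = t * v $ i"
proof -
  define t where "t = Min ((\<lambda>i. x $ i / v $ i) ` {..<n})"
  have fin: "finite ((\<lambda>i. x $ i / v $ i) ` {..<n})" "(\<lambda>i. x $ i / v $ i) ` {..<n} \<noteq> {}"
    using n_pos by auto
  obtain s where s: "s < n" "x $ s / v $ s = t"
    using Min_in[OF fin] by (auto simp: t_def)
  have tle: "t \<le> x $ i / v $ i" if "i < n" for i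
    using Min_le[OF fin(1)] that by (auto simp: t_def)
  define y where "y = x - t \<cdot>\<^sub>v v"
  have y: "y \<in> carrier_vec n" using x v by (simp add: y_def)
  have yi: "y $ i = x $ i - t * v $ i" if "i < n" for i using that x v by (simp add: y_def)
  have y0: "0 \<le> y $ i" if "i < n" for i
    using tle[OF that] v_pos[OF that] that by (simp add: yi field_simps)
  have ys: "y $ s = 0" using s v_pos[OF s(1)] by (simp add: yi field_simps)
  have Ry: "R *\<^sub>v y = y"
    unfolding y_def using x v R right
    by (simp add: mult_minus_distrib_mat_vec[of _ n n] mult_mat_vec[of _ n n])
  have "y $ i = 0" if i: "i < n" for i
  proof -
    obtain k where k: "(R ^\<^sub>m k) $$ (s,i) > 0"
      using irred R s i by (auto simp: irreducible_mat_def)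
    have "(R ^\<^sub>m k) $$ (s,i) * y $ i \<le> (\<Sum>j<n. (R ^\<^sub>m k) $$ (s,j) * y $ j)"
      using i s y0 pow_nonneg by (intro member_le_sum) auto
    also have "\<dots> = ((R ^\<^sub>m k) *\<^sub>v y) $ s"
      using mult_mat_vec_index[of "R ^\<^sub>m k" n y s] R y s by simp
    also have "\<dots> = 0" using pow_fixed[OF y Ry] ys by simp
    finally show ?thesis using k y0[OF i] by (simp add: mult_le_0_iff)
  qed
  then show ?thesis using that[of t] yi by simp
qed

lemma fixed_vec:
  assumes x: "x \<in> carrier_vec n" "A *\<^sub>v x = x"
  obtains c where "\<And>i. i < n \<Longrightarrow> x $ i = c * of_real (v $ i)"
proof -
  have e: "(\<Sum>j<n. of_real (R $$ (i,j)) * x $ j) = x $ i" if "i < n" for i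
    using mult_mat_vec_index[OF A, of x i] x that by (simp add: A_index)
  have "R *\<^sub>v map_vec Re x = map_vec Re x"
  proof (rule eq_vecI)
    fix i assume "i < dim_vec (map_vec Re x)"
    then show "(R *\<^sub>v map_vec Re x) $ i = map_vec Re x $ i"
      using arg_cong[OF e[of i], of Re] mult_mat_vec_index[OF R, of "map_vec Re x" i] x by simp
  qed (use x R in auto)
  then obtain a where a: "\<And>i. i < n \<Longrightarrow> map_vec Re x $ i = a * v $ i"
    using real_fixed_vec[of "map_vec Re x"] x by auto
  have "R *\<^sub>v map_vec Im x = map_vec Im x"
  proof (rule eq_vecI)
    fix i assume "i < dim_vec (map_vec Im x)"
    then show "(R *\<^sub>v map_vec Im x) $ i = map_vec Im x $ i"
      using arg_cong[OF e[of i], of Im] mult_mat_vec_index[OF R, of "map_vec Im x" i] x by simp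
  qed (use x R in auto)
  then obtain b where b: "\<And>i. i < n \<Longrightarrow> map_vec Im x $ i = b * v $ i"
    using real_fixed_vec[of "map_vec Im x"] x by auto
  show ?thesis
  proof (rule that[of "Complex a b"])
    fix i assume "i < n"
    then show "x $ i = Complex a b * of_real (v $ i)"
      using a[of i] b[of i] x by (simp add: complex_eq_iff)
  qed
qed

text \<open>With 1 twice in front of the triangular form, the first column of \<open>P\<close> is a
  multiple of \<open>v\<close>. Pairing the second column with \<open>u\<close> shows that the
  off-diagonal entry \<open>B $$ (0,1)\<close> vanishes, because \<open>u\<close> is not orthogonal
  to \<open>v\<close>. So the second column is fixed too, hence also a multiple of \<open>v\<close>,
  although \<open>P\<close> is invertible.\<close>

lemma simple_eigenvalue:
  assumes "char_poly A = (\<Prod>e\<leftarrow>1 # es. [:- e, 1:])"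
  shows "1 \<notin> set es"
proof
  assume "1 \<in> set es"
  then have "mset es = mset (1 # remove1 1 es)" by simp
  then have "mset (map (\<lambda>e. [:- e, 1:]) (1 # es)) = mset (map (\<lambda>e. [:- e, 1:]) (1 # 1 # remove1 1 es))"
    by (metis mset.simps(2) mset_map)
  then have cp: "char_poly A = (\<Prod>e\<leftarrow>1 # 1 # remove1 1 es. [:- e, 1:])"
    unfolding assms by (metis prod_mset_prod_list)
  obtain B P Q where S: "B \<in> carrier_mat n n" "P \<in> carrier_mat n n" "Q \<in> carrier_mat n n"
      "P * Q = 1\<^sub>m n" "Q * P = 1\<^sub>m n" "A * P = P * B" and tri: "upper_triangular B"
    and len0: "length (1 # 1 # remove1 1 es) = n"
    and diag: "\<forall>i<n. B $$ (i,i) = (1 # 1 # remove1 1 es) ! i"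
    by (rule schur_triangularization[OF A cp])
  have len: "0 < n" "1 < n" using len0 by auto
  have B: "B $$ (0,0) = 1" "B $$ (1,1) = 1" using diag len by auto
  have APc: "A *\<^sub>v col P j = P *\<^sub>v col B j" if "j < n" for j
    using col_mult2[OF A S(2) that] col_mult2[OF S(2,1) that] S(6) by simp
  have colB: "(P *\<^sub>v col B j) $ i = (\<Sum>k\<le>j. P $$ (i,k) * B $$ (k,j))" if "i < n" "j < n" for i j
  proof -
    have "(P *\<^sub>v col B j) $ i = (\<Sum>k<n. P $$ (i,k) * B $$ (k,j))"
      using mult_mat_vec_index[OF S(2), of "col B j" i] S(1) that by simp
    also have "\<dots> = (\<Sum>k\<le>j. P $$ (i,k) * B $$ (k,j))"
      using that tri S(1) by (intro sum.mono_neutral_right) (auto simp: upper_triangular_def)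
    finally show ?thesis .
  qed
  have c0: "A *\<^sub>v col P 0 = col P 0"
    using S len by (intro eq_vecI) (simp_all add: APc colB B del: index_mult_mat_vec)
  have c1: "(A *\<^sub>v col P 1) $ i = B $$ (0,1) * P $$ (i,0) + P $$ (i,1)" if "i < n" for i
    using len that APc[of 1] colB[of i 1] B by (simp add: mult.commute)
  have col: "col P j \<in> carrier_vec n" for j using S by auto
  obtain c where c: "\<And>i. i < n \<Longrightarrow> P $$ (i,0) = c * of_real (v $ i)"
    using fixed_vec[OF col c0] S(2) len by auto
  have QP: "(\<Sum>k<n. Q $$ (i,k) * P $$ (k,j)) = (if i = j then 1 else 0)" if "i < n" "j < n" for i j
    using mult_mat_mat_index[OF S(3,2) that] S(5) that by simp
  have cnz: "c \<noteq> 0" using QP[of 0 0] c len by auto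
  have "(\<Sum>i<n. of_real (u $ i) * (B $$ (0,1) * P $$ (i,0) + P $$ (i,1))) = (\<Sum>i<n. of_real (u $ i) * P $$ (i,1))"
    using left_eigen[OF col[of 1]] c1 S(2) len by (simp del: index_mult_mat_vec)
  then have "B $$ (0,1) * (\<Sum>i<n. of_real (u $ i) * P $$ (i,0)) = 0"
    by (simp add: algebra_simps sum.distrib sum_distrib_left)
  moreover have "(\<Sum>i<n. of_real (u $ i) * P $$ (i,0)) = c"
  proof -
    have "(\<Sum>i<n. of_real (u $ i) * P $$ (i,0)) = c * of_real (\<Sum>i<n. u $ i * v $ i)"
      by (simp add: c sum_distrib_left mult_ac)
    then show ?thesis by (simp add: uv_sum)
  qed
  ultimately have "B $$ (0,1) = 0" using cnz by simp
  then have "A *\<^sub>v col P 1 = col P 1"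
    using S len c1 R by (intro eq_vecI) (simp_all del: index_mult_mat_vec)
  then obtain c' where c': "\<And>i. i < n \<Longrightarrow> P $$ (i,1) = c' * of_real (v $ i)"
    using fixed_vec[OF col[of 1]] S(2) len by auto
  \<comment> \<open>Applying \<open>Q\<close> makes two columns of the identity matrix
    proportional.\<close>
  have "(if j = 1 then 1 else 0) = c' / c * (if j = 0 then 1 else 0)" if "j < n" for j
  proof -
    have "(\<Sum>k<n. Q $$ (j,k) * P $$ (k,1)) = c' / c * (\<Sum>k<n. Q $$ (j,k) * P $$ (k,0))"
      using cnz by (simp add: c c'[simplified] sum_distrib_left mult_ac)
    then show ?thesis using QP[OF that, of 1] QP[OF that, of 0] len by simp
  qed
  from this[of 1] show False using len by simp
qed

end

section \<open>Geometric decay on the kernel of \<open>u\<close>\<close>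

text \<open>The inner product with weights \<open>\<omega>\<close>, written in the coordinates of
  the triangularization: \<open>a\<close> stands for the vector \<open>P a\<close>.\<close>

definition pullback_form :: "nat \<Rightarrow> complex mat \<Rightarrow> (nat \<Rightarrow> real) \<Rightarrow> (nat \<Rightarrow> complex) \<Rightarrow> (nat \<Rightarrow> complex) \<Rightarrow> complex" where
  "pullback_form n P \<omega> a b =
     (\<Sum>k<n. of_real (\<omega> k) * (\<Sum>j<n. P $$ (k,j) * a j) * cnj (\<Sum>j<n. P $$ (k,j) * b j))"

lemma pullback_form_self:
  "Re (pullback_form n P \<omega> a a) = (\<Sum>k<n. \<omega> k * (cmod (\<Sum>j<n. P $$ (k,j) * a j))\<^sup>2)"
  unfolding pullback_form_def Re_sum
  by (intro sum.cong refl) (simp only: mult.assoc complex_norm_square[symmetric] flip: of_real_mult, simp)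

lemma psd_pullback_form:
  assumes "\<And>k. k < n \<Longrightarrow> 0 \<le> \<omega> k"
  shows "psd_form (pullback_form n P \<omega>)"
proof
  fix x y z t
  have "(\<Sum>j<n. P $$ (k,j) * (x j + t * y j)) = (\<Sum>j<n. P $$ (k,j) * x j) + t * (\<Sum>j<n. P $$ (k,j) * y j)" for k
    by (simp add: algebra_simps sum.distrib sum_distrib_left)
  then show "pullback_form n P \<omega> (\<lambda>k. x k + t * y k) z = pullback_form n P \<omega> x z + t * pullback_form n P \<omega> y z"
    by (simp only: pullback_form_def) (simp only: algebra_simps sum.distrib sum_distrib_left)
  show "cnj (pullback_form n P \<omega> x y) = pullback_form n P \<omega> y x"
    by (simp add: pullback_form_def mult_ac)
  show "0 \<le> Re (pullback_form n P \<omega> x x)"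
    unfolding pullback_form_self using assms by (intro sum_nonneg) auto
qed

context pf_matrix
begin

lemma left_eigen_pow:
  fixes z :: "complex vec"
  assumes "z \<in> carrier_vec n"
  shows "(\<Sum>i<n. of_real (u $ i) * ((A ^\<^sub>m N) *\<^sub>v z) $ i) = (\<Sum>i<n. of_real (u $ i) * z $ i)"
  using assms
proof (induction N arbitrary: z)
  case (Suc N)
  have "(A ^\<^sub>m Suc N) *\<^sub>v z = (A ^\<^sub>m N) *\<^sub>v (A *\<^sub>v z)"
    using assoc_mult_mat_vec[of "A ^\<^sub>m N" n n A n z] A Suc.prems by simp
  moreover have "A *\<^sub>v z \<in> carrier_vec n" using A Suc.prems by simp
  ultimately show ?case using Suc.IH[of "A *\<^sub>v z"] left_eigen[OF Suc.prems] by simp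
qed (use R in auto)

text \<open>Dividing out the first basis vector, a multiple of \<open>v\<close>, removes the
  eigenvalue 1, and the Lyapunov function exists for the quotient. On the kernel of
  \<open>u\<close>, which \<open>A\<close> preserves, the quotient form agrees with the original
  one.\<close>

lemma decay:
  assumes cp: "char_poly A = (\<Prod>e\<leftarrow>1 # es. [:- e, 1:])"
    and es: "\<And>e. e \<in> set es \<Longrightarrow> (cmod e)\<^sup>2 \<le> 1 - d" and d: "0 < d" "d \<le> 4"
    and z: "z \<in> carrier_vec n" and uz: "(\<Sum>i<n. of_real (u $ i) * z $ i) = 0"
  shows "(\<Sum>i<n. u $ i / v $ i * (cmod (((A ^\<^sub>m N) *\<^sub>v z) $ i))\<^sup>2)
     \<le> 3 ^ n * (1 - d / 4) ^ N * (\<Sum>i<n. u $ i / v $ i * (cmod (z $ i))\<^sup>2)"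
proof -
  obtain B P Q where S: "B \<in> carrier_mat n n" "P \<in> carrier_mat n n" "Q \<in> carrier_mat n n"
      "P * Q = 1\<^sub>m n" "Q * P = 1\<^sub>m n" "A * P = P * B" and tri: "upper_triangular B"
    and len: "length (1 # es) = n" and diag: "\<forall>i<n. B $$ (i,i) = (1 # es) ! i"
    by (rule schur_triangularization[OF A cp])
  define \<omega> where "\<omega> = (\<lambda>k. u $ k / v $ k)"
  define h where "h = pullback_form n P \<omega>"
  \<comment> \<open>\<open>T\<close> is \<open>B\<close> acting on coordinates; \<open>F\<close>
    below turns coordinates into vectors and intertwines \<open>T\<close> with
    \<open>A\<close>.\<close>
  define T :: "(nat \<Rightarrow> complex) \<Rightarrow> nat \<Rightarrow> complex"
    where "T = (\<lambda>a i. if i < n then \<Sum>j<n. B $$ (i,j) * a j else 0)"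
  define w where "w = unit_fun 0" \<comment> \<open>the coordinates of a multiple of \<open>v\<close>\<close>
  define g where "g = quot_form h w"
  define F where "F = (\<lambda>a :: nat \<Rightarrow> complex. P *\<^sub>v vec n a)"
  have F: "F a \<in> carrier_vec n" for a using S by (auto simp: F_def)
  have Fi: "(\<Sum>j<n. P $$ (i,j) * a j) = F a $ i" if "i < n" for a i
    using that S by (simp add: F_def mult_mat_vec_index[OF S(2)] del: index_mult_mat_vec)
  have hF: "Re (h a a) = (\<Sum>i<n. u $ i / v $ i * (cmod (F a $ i))\<^sup>2)" for a
    by (simp add: h_def pullback_form_self Fi \<omega>_def)
  have FT: "F (T a) = A *\<^sub>v F a" for a
  proof -
    have "vec n (T a) = B *\<^sub>v vec n a"
      using S(1) by (intro eq_vecI)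
        (auto simp: T_def mult_mat_vec_index[OF S(1)] simp del: index_mult_mat_vec)
    then have "F (T a) = (P * B) *\<^sub>v vec n a"
      unfolding F_def using S by (simp add: assoc_mult_mat_vec[of _ n n _ n])
    also have "\<dots> = A *\<^sub>v F a"
      unfolding F_def S(6)[symmetric] by (rule assoc_mult_mat_vec[OF A S(2) vec_carrier])
    finally show ?thesis .
  qed
  interpret psd_form h unfolding h_def
    by (rule psd_pullback_form) (simp add: \<omega>_def u_pos v_pos less_imp_le)
  have gpsd: "psd_form g" unfolding g_def by (rule quot_form_psd)
  interpret g: psd_form g by (rule gpsd)
  have lin: "T (\<lambda>k. x k + t * y k) = (\<lambda>k. T x k + t * T y k)" for x y t
    by (auto simp: T_def fun_eq_iff algebra_simps sum.distrib sum_distrib_left)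
  have contr: "Re (h (T x) (T x)) \<le> Re (h x x)" for x
    unfolding hF FT by (rule contraction[OF F])
  have T_unit: "T (unit_fun i) j = (if j < n \<and> i < n then B $$ (j,i) else 0)" for i j
    by (simp add: T_def unit_fun_def if_distrib cong: if_cong)
  have T_tri: "T (unit_fun i) j = 0" if "i < j" "j < n" for i j
    using that tri S(1) by (simp add: T_unit upper_triangular_def)
  have fl: "flag_null h 0 n"
    unfolding flag_null_def h_def pullback_form_def by auto
  have eig: "h (\<lambda>k. T w k - 1 * w k) (\<lambda>k. T w k - 1 * w k) = 0"
  proof -
    have "T w j - 1 * w j = 0" if "j \<in> {0..<n}" for j
      using that T_tri[of 0 j] T_unit[of 0 0] diag n_pos
      by (cases "j = 0") (auto simp: w_def unit_fun_def)
    then show ?thesis by (intro fl[unfolded flag_null_def, rule_format])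
  qed
  have gcontr: "Re (g (T x) (T x)) \<le> Re (g x x)" for x
    unfolding g_def by (rule quot_form_contraction(1)[OF lin contr eig])
  have gfl: "flag_null g 1 n"
    unfolding g_def using flag_null_quot_form[OF psd_form_axioms fl, of w]
    by (auto simp: w_def unit_fun_def)
  have Tdiag: "(cmod (T (unit_fun i) i))\<^sup>2 \<le> 1 - d" if "1 \<le> i" "i < n" for i
  proof -
    have "T (unit_fun i) i = es ! (i - 1)" using that diag by (simp add: T_unit)
    then show ?thesis using es[of "es ! (i - 1)"] that len by (simp add: nth_mem)
  qed
  obtain V where V: "\<And>x. Re (g x x) \<le> V x" "\<And>x. V x \<le> (3 ^ (n - 1) - 1) * Re (g x x)"
      "\<And>x. V (T x) \<le> (1 - d / 4) * V x - d / 4 * Re (g x x)"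
    using triangular_contraction_lyapunov[of g T n 1 d, OF gpsd lin gcontr T_tri Tdiag d(1) gfl] n_pos
    by (auto simp: Suc_le_eq)
  define a where "a = (\<lambda>i. (Q *\<^sub>v z) $ i)"
  have Fa: "F a = z"
  proof -
    have "vec n a = Q *\<^sub>v z" unfolding a_def using S(3) by (intro eq_vecI) auto
    then show ?thesis
      unfolding F_def using S z by (simp add: assoc_mult_mat_vec[of _ n n _ n, symmetric])
  qed
  have FTN: "F ((T ^^ N) b) = (A ^\<^sub>m N) *\<^sub>v F b" for b
  proof (induction N arbitrary: b)
    case 0 then show ?case using F[of b] R by simp
  next
    case (Suc N)
    have "F ((T ^^ Suc N) b) = (A ^\<^sub>m N) *\<^sub>v (A *\<^sub>v F b)"
      using Suc.IH[of "T b"] by (simp add: funpow_swap1 FT)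
    also have "\<dots> = (A ^\<^sub>m Suc N) *\<^sub>v F b"
      using assoc_mult_mat_vec[of "A ^\<^sub>m N" n n A n "F b"] A F by simp
    finally show ?case .
  qed
  have VTN: "V ((T ^^ N) a) \<le> (1 - d / 4) ^ N * V a"
  proof (induction N)
    case (Suc N)
    have "0 \<le> d / 4 * Re (g x x)" for x
      using g.nonneg[of x] d by simp
    then have "V (T ((T ^^ N) a)) \<le> (1 - d / 4) * V ((T ^^ N) a)"
      using V(3)[of "(T ^^ N) a"] by (smt (verit))
    also have "(1 - d / 4) * V ((T ^^ N) a) \<le> (1 - d / 4) * ((1 - d / 4) ^ N * V a)"
      using Suc d by (intro mult_left_mono) auto
    finally show ?case by (simp add: mult_ac)
  qed simp
  have w0: "F w = col P 0"
    using n_pos S(2) by (intro eq_vecI)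
      (simp_all add: F_def w_def unit_fun_def mult_mat_vec_index[OF S(2)] if_distrib cong: if_cong del: index_mult_mat_vec)
  have "A *\<^sub>v F w = F w"
  proof (rule eq_vecI)
    show "dim_vec (A *\<^sub>v F w) = dim_vec (F w)" using F[of w] R by simp
    fix i assume "i < dim_vec (F w)"
    then have i: "i < n" using F[of w] by simp
    have "T w j = w j" if "j < n" for j
      using that T_tri[of 0 j] T_unit[of 0 0] diag n_pos
      by (cases "j = 0") (auto simp: w_def unit_fun_def)
    then have "vec n (T w) = vec n w" by (intro eq_vecI) auto
    then show "(A *\<^sub>v F w) $ i = F w $ i" by (simp add: FT[symmetric]) (simp add: F_def)
  qed
  then obtain c where c: "\<And>i. i < n \<Longrightarrow> F w $ i = c * of_real (v $ i)"
    using fixed_vec[OF F] by blast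
  \<comment> \<open>The weight \<open>u / v\<close> times \<open>v\<close> is \<open>u\<close>, so
    being annihilated by \<open>u\<close> implies orthogonality to \<open>w\<close>.\<close>
  have gh: "Re (g b b) = Re (h b b)" if "(\<Sum>i<n. of_real (u $ i) * F b $ i) = 0" for b
  proof -
    have "h b w = (\<Sum>k<n. cnj c * (of_real (u $ k) * F b $ k))"
      unfolding h_def pullback_form_def
      by (intro sum.cong refl)
        (auto simp: Fi c \<omega>_def dest: v_pos)
    also have "\<dots> = 0" using that by (simp flip: sum_distrib_left)
    finally show ?thesis by (simp add: g_def quot_form_self)
  qed
  have "(\<Sum>i<n. u $ i / v $ i * (cmod (((A ^\<^sub>m N) *\<^sub>v z) $ i))\<^sup>2) = Re (h ((T ^^ N) a) ((T ^^ N) a))"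
    by (simp add: hF FTN Fa)
  also have "\<dots> = Re (g ((T ^^ N) a) ((T ^^ N) a))"
    by (rule gh[symmetric]) (simp add: FTN Fa left_eigen_pow[OF z] uz)
  also have "\<dots> \<le> V ((T ^^ N) a)" by (rule V)
  also have "\<dots> \<le> (1 - d / 4) ^ N * V a" by (rule VTN)
  also have "\<dots> \<le> (1 - d / 4) ^ N * (3 ^ n * Re (g a a))"
  proof (intro mult_left_mono)
    have "(3::real) ^ (n - 1) - 1 \<le> 3 ^ n" using power_increasing[of "n - 1" n "3::real"] by linarith
    then have "(3 ^ (n - 1) - 1) * Re (g a a) \<le> 3 ^ n * Re (g a a)"
      by (rule mult_right_mono[OF _ g.nonneg])
    then show "V a \<le> 3 ^ n * Re (g a a)" using V(2)[of a] by simp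
  qed (use d in auto)
  also have "Re (g a a) = Re (h a a)" by (rule gh) (simp add: Fa uz)
  finally show ?thesis by (simp add: hF Fa mult_ac)
qed

end

section \<open>The spectral gap as a bound on the other eigenvalues\<close>

text \<open>Index 1 is the entry read by \<open>spectral_gap\<close>. Once a single copy of the top
  value \<open>m\<close> is set aside, it is the maximum of what remains.\<close>

lemma rev_sort_second:
  fixes xs :: "'a :: linorder list"
  assumes "xs \<noteq> []" and le: "\<And>x. x \<in> set xs \<Longrightarrow> x \<le> m"
  shows "rev (sort (m # xs)) ! 1 \<in> set xs"
    and "\<And>x. x \<in> set xs \<Longrightarrow> x \<le> rev (sort (m # xs)) ! 1"
proof -
  have "sort (m # xs) = sort xs @ [m]"
    by (rule properties_for_sort) (auto simp: sorted_append le)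
  moreover have ne: "sort xs \<noteq> []"
    using assms(1) by (metis length_0_conv length_sort)
  ultimately have eq: "rev (sort (m # xs)) ! 1 = last (sort xs)"
    by (simp add: hd_conv_nth[symmetric] hd_rev)
  then show "rev (sort (m # xs)) ! 1 \<in> set xs"
    using last_in_set[OF ne] by simp
  fix x assume "x \<in> set xs"
  then have "x \<in> set (butlast (sort xs) @ [last (sort xs)])" using ne by simp
  moreover have "sorted (butlast (sort xs) @ [last (sort xs)])" using ne by simp
  ultimately show "x \<le> rev (sort (m # xs)) ! 1"
    unfolding eq sorted_append by auto
qed

lemma proots_linear_factors:
  fixes as :: "'a :: idom list"
  shows "proots (\<Prod>a\<leftarrow>as. [:- a, 1:]) = mset as"
proof (induction as)
  case (Cons a as)
  have "(\<Prod>a\<leftarrow>as. [:- a, 1:]) \<noteq> 0" by (auto simp: prod_list_zero_iff)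
  then show ?case using Cons by (simp add: proots_mult del: mult_pCons_left)
qed simp

context pf_matrix
begin

lemma eigenvalue_1: "eigenvalue A 1"
proof -
  have "A *\<^sub>v map_vec of_real v = map_vec complex_of_real v"
    using of_real_hom.mult_mat_vec_hom[OF R v, where ?'a = complex] right by simp
  moreover have "map_vec complex_of_real v \<noteq> 0\<^sub>v n"
  proof
    assume "map_vec complex_of_real v = 0\<^sub>v n"
    then have "map_vec complex_of_real v $ 0 = 0" using n_pos by simp
    then show False using v n_pos v_pos[of 0] by simp
  qed
  ultimately show ?thesis unfolding eigenvalue_def eigenvector_def using R v by (intro exI[of _ "map_vec of_real v"]) auto
qed

text \<open>On the disc of \<open>eigenvalue_disc\<close> the real part lies between 0 and 1, and
  equals 1 only at the point 1, which simplicity excludes from \<open>es\<close>. The squared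
  modulus is at most the real part, hence at most the second largest one; \<open>n2\<close> ensures
  that \<open>es\<close> is nonempty.\<close>

lemma spectral_gap_bounds:
  assumes n2: "2 \<le> n"
  obtains es where "char_poly A = (\<Prod>e\<leftarrow>1 # es. [:- e, 1:])"
    "\<forall>e\<in>set es. (cmod e)\<^sup>2 \<le> 1 - spectral_gap R"
    "0 < spectral_gap R" "spectral_gap R \<le> 1"
proof -
  obtain as where as: "char_poly A = (\<Prod>a\<leftarrow>as. [:- a, 1:])" and len: "length as = n"
    using char_poly_factorized[OF A] by blast
  have ev: "eigenvalue A e" if "e \<in> set as" for e
    using that by (auto simp: eigenvalue_root_char_poly[OF A] as poly_prod_list prod_list_zero_iff)
  have "1 \<in> set as"
    using eigenvalue_1 by (auto simp: eigenvalue_root_char_poly[OF A] as poly_prod_list prod_list_zero_iff)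
  define es where "es = remove1 1 as"
  have mset: "mset as = mset (1 # es)" using \<open>1 \<in> set as\<close> by (simp add: es_def)
  then have "mset (map (\<lambda>e. [:- e, 1:]) as) = mset (map (\<lambda>e. [:- e, 1:]) (1 # es))"
    by (metis mset_map)
  then have cp: "char_poly A = (\<Prod>e\<leftarrow>1 # es. [:- e, 1:])"
    unfolding as by (metis prod_mset_prod_list)
  have esA: "e \<in> set as" if "e \<in> set es" for e using that unfolding es_def by (meson notin_set_remove1)
  have disc: "(cmod e)\<^sup>2 \<le> Re e" if "e \<in> set es" for e
    by (rule eigenvalue_disc[OF ev[OF esA[OF that]]])
  have Re: "0 \<le> Re e" "Re e < 1" if "e \<in> set es" for e
  proof -
    have d: "(Re e)\<^sup>2 + (Im e)\<^sup>2 \<le> Re e" using disc[OF that] by (simp add: cmod_power2)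
    then show "0 \<le> Re e" by (smt (verit) zero_le_power2)
    have "(Re e)\<^sup>2 \<le> Re e" using d by (smt (verit) zero_le_power2)
    then have le: "Re e \<le> 1"
      using mult_strict_left_mono[of 1 "Re e" "Re e"] by (auto simp: power2_eq_square not_less[symmetric])
    moreover have "Re e \<noteq> 1"
    proof
      assume "Re e = 1"
      then have "e = 1" using d by (simp add: complex_eq_iff)
      then show False using that simple_eigenvalue[OF cp] by simp
    qed
    ultimately show "Re e < 1" by simp
  qed
  define s where "s = rev (sort (1 # map Re es)) ! 1"
  have gap: "spectral_gap R = 1 - s"
  proof -
    have "image_mset Re (eigenvalues_mset R) = mset (1 # map Re es)"
      by (simp add: eigenvalues_mset_def as proots_linear_factors mset)
    then show ?thesis unfolding spectral_gap_def s_def by (simp only: sorted_list_of_multiset_mset)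
  qed
  have ne: "map Re es \<noteq> []" using len n2 arg_cong[OF mset, of size] by auto
  have le1: "x \<le> 1" if "x \<in> set (map Re es)" for x using that Re by (auto simp: less_imp_le)
  have "s \<in> set (map Re es)" unfolding s_def by (rule rev_sort_second(1)[OF ne le1])
  then have "0 \<le> s" "s < 1" using Re by auto
  moreover have "(cmod e)\<^sup>2 \<le> 1 - spectral_gap R" if "e \<in> set es" for e
  proof -
    have "Re e \<le> s" unfolding s_def using that by (intro rev_sort_second(2)[OF ne le1]) auto
    then show ?thesis using disc[OF that] gap by simp
  qed
  ultimately show ?thesis using that[OF cp] gap by simp
qed

lemma real_decay:
  assumes n2: "2 \<le> n" and z: "z \<in> carrier_vec n" and uz: "(\<Sum>i<n. u $ i * z $ i) = 0"
  shows "(\<Sum>i<n. u $ i / v $ i * (((R ^\<^sub>m N) *\<^sub>v z) $ i)\<^sup>2)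
     \<le> 3 ^ n * (1 - spectral_gap R / 4) ^ N * (\<Sum>i<n. u $ i / v $ i * (z $ i)\<^sup>2)"
proof -
  obtain es where es: "char_poly A = (\<Prod>e\<leftarrow>1 # es. [:- e, 1:])"
    "\<forall>e\<in>set es. (cmod e)\<^sup>2 \<le> 1 - spectral_gap R"
    and gap: "0 < spectral_gap R" "spectral_gap R \<le> 1"
    by (rule spectral_gap_bounds[OF n2])
  define cz where "cz = map_vec complex_of_real z"
  have cz: "cz \<in> carrier_vec n" using z by (simp add: cz_def)
  have "(\<Sum>i<n. of_real (u $ i) * cz $ i) = of_real (\<Sum>i<n. u $ i * z $ i)"
    using z by (simp add: cz_def)
  then have ucz: "(\<Sum>i<n. of_real (u $ i) * cz $ i) = 0" using uz by simp
  have "(A ^\<^sub>m N) *\<^sub>v cz = map_vec of_real ((R ^\<^sub>m N) *\<^sub>v z)"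
    unfolding cz_def of_real_hom.mat_hom_pow[OF R, symmetric]
    by (rule of_real_hom.mult_mat_vec_hom[symmetric]) (use R z in auto)
  then have "cmod (((A ^\<^sub>m N) *\<^sub>v cz) $ i) = \<bar>((R ^\<^sub>m N) *\<^sub>v z) $ i\<bar>" if "i < n" for i
    using that R by (simp del: index_mult_mat_vec)
  moreover have "cmod (cz $ i) = \<bar>z $ i\<bar>" if "i < n" for i
    using that z by (simp add: cz_def)
  ultimately show ?thesis
    using decay[OF es(1) _ gap(1) _ cz ucz, of N] es(2) gap(2)
    by (simp del: index_mult_mat_vec)
qed

section \<open>Comparison with the weighted 1-norm and the mixing time\<close>

lemma norm1_diag:
  assumes "x \<in> carrier_vec n"
  shows "norm1_vec (diag_of_vec u *\<^sub>v x) = (\<Sum>i<n. u $ i * \<bar>x $ i\<bar>)"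
proof -
  have D: "diag_of_vec u \<in> carrier_mat n n" using u by (simp add: diag_of_vec_def)
  have "(diag_of_vec u *\<^sub>v x) $ i = u $ i * x $ i" if "i < n" for i
  proof -
    have "(diag_of_vec u *\<^sub>v x) $ i = (\<Sum>j<n. diag_of_vec u $$ (i,j) * x $ j)"
      using mult_mat_vec_index[OF D] assms that by simp
    also have "\<dots> = (\<Sum>j<n. if i = j then u $ j * x $ j else 0)"
      using that u by (intro sum.cong refl) (simp add: diag_of_vec_def)
    finally have "(diag_of_vec u *\<^sub>v x) $ i = (\<Sum>j<n. if i = j then u $ j * x $ j else 0)" .
    then show ?thesis using that by simp
  qed
  then show ?thesis
    using D by (simp add: norm1_vec_def abs_mult u_pos less_imp_le del: index_mult_mat_vec)
qed

lemma kappa_bounds: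
  shows "0 < kappa u v" "kappa u v \<le> 1" "\<And>i. i < n \<Longrightarrow> kappa u v \<le> u $ i * v $ i"
proof -
  have k: "kappa u v = Min ((\<lambda>i. u $ i * v $ i) ` {..<n})" using u by (simp add: kappa_def)
  have fin: "finite ((\<lambda>i. u $ i * v $ i) ` {..<n})" "(\<lambda>i. u $ i * v $ i) ` {..<n} \<noteq> {}"
    using n_pos by auto
  show "0 < kappa u v" unfolding k using fin u_pos v_pos by (subst Min_gr_iff) auto
  show le: "kappa u v \<le> u $ i * v $ i" if "i < n" for i
    unfolding k using that fin by (intro Min_le) auto
  have "u $ 0 * v $ 0 \<le> (\<Sum>i<n. u $ i * v $ i)"
    using n_pos u_pos v_pos by (intro member_le_sum) (auto simp: less_imp_le)
  then show "kappa u v \<le> 1" using le[OF n_pos] uv_sum by simp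
qed

text \<open>The matrix difference sends \<open>x\<close> to \<open>y\<close>, the image under the
  power of \<open>R\<close> of the part \<open>z\<close> of \<open>x\<close> in the kernel of
  \<open>u\<close>. Going from the 1-norm to the 2-norm of \<open>y\<close> is free, since the
  \<open>u i * v i\<close> sum to 1; the way back for \<open>z\<close> costs
  \<open>1 / kappa u v\<close>.\<close>

lemma distance_bound:
  assumes n2: "2 \<le> n" and x: "x \<in> carrier_vec n" and x1: "norm1_vec (diag_of_vec u *\<^sub>v x) = 1"
  shows "(norm1_vec (diag_of_vec u *\<^sub>v ((R ^\<^sub>m N - mat n n (\<lambda>(i,j). v $ i * u $ j)) *\<^sub>v x)))\<^sup>2
    \<le> 3 ^ n * (1 - spectral_gap R / 4) ^ N / kappa u v"
proof -
  define s where "s = (\<Sum>i<n. u $ i * x $ i)"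
  define z where "z = x - s \<cdot>\<^sub>v v"
  define y where "y = (R ^\<^sub>m N) *\<^sub>v z"
  define M where "M = mat n n (\<lambda>(i,j). v $ i * u $ j)"
  define G where "G = 3 ^ n * (1 - spectral_gap R / 4) ^ N"
  have G: "0 \<le> G" unfolding G_def by (rule spectral_gap_bounds[OF n2]) simp
  have z: "z \<in> carrier_vec n" using x v by (simp add: z_def)
  have RN: "R ^\<^sub>m N \<in> carrier_mat n n" using R by simp
  have M: "M \<in> carrier_mat n n" by (simp add: M_def)
  have y: "y \<in> carrier_vec n" using RN z by (simp add: y_def)
  have zi: "z $ i = x $ i - s * v $ i" if "i < n" for i using that x v by (simp add: z_def)
  have "M *\<^sub>v x = s \<cdot>\<^sub>v v"
  proof (rule eq_vecI)
    fix i assume "i < dim_vec (s \<cdot>\<^sub>v v)"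
    then have i: "i < n" using v by simp
    have "(M *\<^sub>v x) $ i = (\<Sum>j<n. v $ i * u $ j * x $ j)"
      using mult_mat_vec_index[OF M, of x i] i x by (simp add: M_def)
    then show "(M *\<^sub>v x) $ i = (s \<cdot>\<^sub>v v) $ i"
      using i v by (simp add: s_def sum_distrib_left mult_ac)
  qed (use M v in auto)
  moreover have "(R ^\<^sub>m N) *\<^sub>v (s \<cdot>\<^sub>v v) = s \<cdot>\<^sub>v v"
    using mult_mat_vec[OF RN v, of s] pow_fixed[OF v right] by simp
  ultimately have "(R ^\<^sub>m N - M) *\<^sub>v x = y"
    unfolding y_def z_def using RN M x v
    by (simp add: minus_mult_distrib_mat_vec mult_minus_distrib_mat_vec)
  then have norm_y: "norm1_vec (diag_of_vec u *\<^sub>v ((R ^\<^sub>m N - M) *\<^sub>v x)) = (\<Sum>i<n. u $ i * \<bar>y $ i\<bar>)"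
    using norm1_diag[OF y] by simp
  have uz: "(\<Sum>i<n. u $ i * z $ i) = 0"
  proof -
    have "(\<Sum>i<n. u $ i * z $ i) = (\<Sum>i<n. u $ i * x $ i) - s * (\<Sum>i<n. u $ i * v $ i)"
      by (simp add: zi algebra_simps sum_subtractf sum_distrib_left)
    then show ?thesis by (simp add: uv_sum s_def)
  qed
  \<comment> \<open>Pythagoras again: \<open>v\<close> is a unit vector of the weighted norm and
    \<open>s\<close> is the coefficient of \<open>x\<close> along it.\<close>
  have "(\<Sum>i<n. u $ i / v $ i * (z $ i)\<^sup>2) = (\<Sum>i<n. u $ i / v $ i * (x $ i)\<^sup>2) - s\<^sup>2"
  proof -
    have "u $ i / v $ i * (z $ i)\<^sup>2 = u $ i / v $ i * (x $ i)\<^sup>2 - 2 * s * (u $ i * x $ i) + s\<^sup>2 * (u $ i * v $ i)"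
      if "i < n" for i
      using v_pos[OF that] by (simp add: zi that field_simps power2_eq_square)
    then have "(\<Sum>i<n. u $ i / v $ i * (z $ i)\<^sup>2)
        = (\<Sum>i<n. u $ i / v $ i * (x $ i)\<^sup>2) - 2 * s * (\<Sum>i<n. u $ i * x $ i) + s\<^sup>2 * (\<Sum>i<n. u $ i * v $ i)"
      by (simp add: sum.distrib sum_subtractf sum_distrib_left)
    then show ?thesis by (simp add: uv_sum flip: s_def) (simp add: power2_eq_square)
  qed
  also have "\<dots> \<le> (\<Sum>i<n. u $ i / v $ i * (x $ i)\<^sup>2)" by simp
  also have "\<dots> \<le> (\<Sum>i<n. u $ i * \<bar>x $ i\<bar> / kappa u v)"
  proof (rule sum_mono)
    fix i assume "i \<in> {..<n}"
    then have i: "i < n" by simp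
    have x1': "(\<Sum>i<n. u $ i * \<bar>x $ i\<bar>) = 1" using x1 norm1_diag[OF x] by simp
    have "u $ i * \<bar>x $ i\<bar> \<le> (\<Sum>i<n. u $ i * \<bar>x $ i\<bar>)"
      using i u_pos by (intro member_le_sum) (auto simp: less_imp_le)
    then have le1: "u $ i * \<bar>x $ i\<bar> \<le> 1" using x1' by simp
    have "u $ i / v $ i * (x $ i)\<^sup>2 = (u $ i * \<bar>x $ i\<bar>) * (u $ i * \<bar>x $ i\<bar>) / (u $ i * v $ i)"
      using u_pos[OF i] v_pos[OF i] by (simp add: field_simps power2_eq_square)
    also have "\<dots> \<le> (u $ i * \<bar>x $ i\<bar>) * 1 / kappa u v"
      using kappa_bounds i le1 u_pos[OF i] v_pos[OF i] by (intro frac_le mult_mono) auto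
    finally show "u $ i / v $ i * (x $ i)\<^sup>2 \<le> u $ i * \<bar>x $ i\<bar> / kappa u v" by simp
  qed
  also have "\<dots> = 1 / kappa u v"
    using x1 norm1_diag[OF x] by (simp flip: sum_divide_distrib)
  finally have zk: "(\<Sum>i<n. u $ i / v $ i * (z $ i)\<^sup>2) \<le> 1 / kappa u v" .
  have "(\<Sum>i<n. u $ i * \<bar>y $ i\<bar>)\<^sup>2 \<le> (\<Sum>i<n. u $ i * v $ i) * (\<Sum>i<n. u $ i * \<bar>y $ i\<bar>\<^sup>2 / v $ i)"
    by (rule weighted_Cauchy_Schwarz) (auto simp: u_pos v_pos less_imp_le)
  also have "\<dots> = (\<Sum>i<n. u $ i / v $ i * (y $ i)\<^sup>2)" by (simp add: uv_sum)
  also have "\<dots> \<le> G * (\<Sum>i<n. u $ i / v $ i * (z $ i)\<^sup>2)"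
    unfolding y_def G_def by (rule real_decay[OF n2 z uz])
  also have "\<dots> \<le> G * (1 / kappa u v)" by (rule mult_left_mono[OF zk G])
  finally show ?thesis by (simp add: norm_y flip: M_def G_def)
qed

lemma mixing_time_bound:
  assumes n2: "2 \<le> n" and e: "0 < \<epsilon>" "\<epsilon> < 1"
  shows "real (mixing_time R u v \<epsilon>) \<le> 9 * (real n + ln (1 / (\<epsilon> * kappa u v))) / spectral_gap R"
proof -
  define d where "d = spectral_gap R"
  have d: "0 < d" "d \<le> 1" unfolding d_def by (rule spectral_gap_bounds[OF n2], simp)+
  define k where "k = kappa u v"
  have k: "0 < k" "k \<le> 1" using kappa_bounds by (auto simp: k_def)
  define L where "L = ln (1 / (\<epsilon> * k))"
  have ek: "\<epsilon> * k \<le> 1" "0 < \<epsilon> * k" using e k by (auto simp: mult_le_one)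
  then have L: "0 \<le> L" "exp (- L) = \<epsilon> * k" by (auto simp: L_def ln_div)
  \<comment> \<open>With factor 8 the power of \<open>1 - d / 4\<close> is at most
    \<open>exp (- 2 * (n + L))\<close>: the part in \<open>n\<close> absorbs
    \<open>3 ^ n \<le> exp (2 * n)\<close>, and the part in \<open>L\<close> yields the square of
    \<open>\<epsilon> * k\<close>.\<close>
  define N where "N = nat \<lceil>8 * (real n + L) / d\<rceil>"
  have N1: "8 * (real n + L) / d \<le> real N" unfolding N_def by linarith
  have N2: "real N \<le> 8 * (real n + L) / d + 1"
    using d L by (simp add: N_def)
  have "3 ^ n * (1 - d / 4) ^ N \<le> exp (2 * real n) * exp (- (d / 4) * real N)"
  proof (rule mult_mono)
    have "(3::real) \<le> exp 2" using exp_ge_add_one_self[of 2] by simp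
    then have "3 ^ n \<le> exp (2::real) ^ n" by (intro power_mono) auto
    then show "3 ^ n \<le> exp (2 * real n)" by (simp add: exp_of_nat_mult[symmetric] mult.commute)
    have "1 - d / 4 \<le> exp (- (d / 4))" using exp_ge_add_one_self[of "- (d / 4)"] by simp
    then have "(1 - d / 4) ^ N \<le> exp (- (d / 4)) ^ N" using d by (intro power_mono) auto
    then show "(1 - d / 4) ^ N \<le> exp (- (d / 4) * real N)"
      by (simp add: exp_of_nat_mult[symmetric] mult.commute)
  qed (use d in auto)
  also have "\<dots> = exp (2 * real n - d / 4 * real N)" by (simp flip: exp_add)
  also have "\<dots> \<le> exp (- L + - L)"
    using N1 d by (simp add: field_simps)
  also have "\<dots> = (\<epsilon> * k)\<^sup>2" by (simp only: exp_add L power2_eq_square)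
  finally have "3 ^ n * (1 - d / 4) ^ N / k \<le> (\<epsilon> * k)\<^sup>2 / k"
    using k by (intro divide_right_mono) auto
  \<comment> \<open>One of the two factors \<open>k\<close> pays for the norm comparison; the other
    is at most 1.\<close>
  also have "\<dots> \<le> \<epsilon>\<^sup>2" using k e by (simp add: power2_eq_square)
  finally have bound: "3 ^ n * (1 - d / 4) ^ N / k \<le> \<epsilon>\<^sup>2" .
  have "mixing_time R u v \<epsilon> \<le> N"
    unfolding mixing_time_def
  proof (rule Least_le, intro ballI impI)
    fix x assume x: "x \<in> carrier_vec (dim_row R)" and x1: "norm1_vec (diag_of_vec u *\<^sub>v x) = 1"
    have dim: "dim_row R = n" using R by simp
    show "norm1_vec (diag_of_vec u *\<^sub>v ((R ^\<^sub>m N - mat (dim_row R) (dim_row R) (\<lambda>(i, j). v $ i * u $ j)) *\<^sub>v x)) \<le> \<epsilon>"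
      unfolding dim
      by (rule power2_le_imp_le[OF order_trans[OF distance_bound[OF n2 x[unfolded dim] x1] bound[unfolded d_def k_def]]])
        (use e in simp)
  qed
  then have "real (mixing_time R u v \<epsilon>) \<le> 8 * (real n + L) / d + 1" using N2 by linarith
  \<comment> \<open>The cost of rounding up is absorbed here, raising the constant from 8 to
    9.\<close>
  also have "1 \<le> (real n + L) / d" using d L n2 by (simp add: field_simps)
  finally show ?thesis by (simp add: L_def d_def k_def algebra_simps add_divide_distrib)
qed

end

theorem theorem1p4:
  "\<exists>c > (0::real). \<forall>n (R :: real mat) (u :: real vec) (v :: real vec) (\<epsilon> :: real).
     n \<ge> 2 \<longrightarrow> R \<in> carrier_mat n n \<longrightarrow>
     nonneg_mat R \<longrightarrow> irreducible_mat R \<longrightarrow> half_lazy R \<longrightarrow>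
     PF_eigenvalue R = 1 \<longrightarrow>
     u \<in> carrier_vec n \<longrightarrow> v \<in> carrier_vec n \<longrightarrow>
     (\<forall>i < n. u $ i > 0) \<longrightarrow> (\<forall>i < n. v $ i > 0) \<longrightarrow>
     transpose_mat R *\<^sub>v u = u \<longrightarrow> R *\<^sub>v v = v \<longrightarrow>
     u \<bullet> v = 1 \<longrightarrow>
     0 < \<epsilon> \<longrightarrow> \<epsilon> < 1 \<longrightarrow>
     real (mixing_time R u v \<epsilon>)
       \<le> c * (real n + ln (1 / (\<epsilon> * kappa u v))) / spectral_gap R"
  by (intro exI[of _ 9] conjI allI impI pf_matrix.mixing_time_bound) (auto intro!: pf_matrix.intro)

end
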